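(* Consider the retransmission policy in the two-source, two-destination random access multicast system with transmission probabilities $(p_1,p_2)\in[0,1]^2$. Let $\mu_{nb}=1/E[T_n]$ be the service rate of source $n$ when the other source is backlogged. Then $$\mu_{1b}\le\min_{m=1,2}\left[p_1(1-p_2)q_{1|1}^{(m)}+p_1p_2\,q_{1|1,2}^{(m)}\right],$$ $$\mu_{2b}\le\min_{m=1,2}\left[(1-p_1)p_2\,q_{2|2}^{(m)}+p_1p_2\,q_{2|1,2}^{(m)}\right].$$ That is, the backlogged service rates are bounded by the respective bounds on the Shannon achievable rates $R_1,R_2$ of the random access system.
   Context: System: time is slotted and two sources $n=1,2$ multicast packets to two destinations $m=1,2$. In each slot a backlogged source $n$ transmits with probability $p_n$, independently of the other source and across slots. $q_{n|n}^{(m)}$ is the probability that the packet from source $n$ is received at destination $m$ given that only $n$ transmits. $q_{n|1,2}^{(m)}$ is the same probability given that both sources transmit. It is assumed that $q_{n|n}^{(m)}>q_{n|1,2}^{(m)}$, and that channels of different source-destination pairs are independent. Feedback is instantaneous and error-free. Retransmission policy: source $n$ keeps transmitting its current packet (with probability $p_n$ in each slot) until both destinations have received it. It then removes the packet from its queue and moves to the next one. Service time: $T_n^{(m)}$ is the number of slots until the current packet of source $n$ is first received at destination $m$, and $T_n=\max_{m=1,2}T_n^{(m)}$ is the service time. When the other source is backlogged (so it transmits in every slot with its transmission probability), $T_1^{(m)}$ is geometric with parameter $p_1(1-p_2)q_{1|1}^{(m)}+p_1p_2q_{1|1,2}^{(m)}$, and $T_2^{(m)}$ is geometric with parameter $(1-p_1)p_2q_{2|2}^{(m)}+p_1p_2q_{2|1,2}^{(m)}$.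 $T_n^{(1)}$ and $T_n^{(2)}$ are in general dependent. If a geometric parameter is $0$, the corresponding time is $+\infty$, and $1/\infty=0$. *)

theory Defs
  imports "HOL-Probability.Probability"
begin

datatype source = S1 | S2
datatype dest = D1 | D2

lemma UNIV_source: "UNIV = {S1, S2}"
  using source.exhaust by blast

lemma UNIV_dest: "UNIV = {D1, D2}"
  using dest.exhaust by blast

instance source :: finite
  by standard (simp add: UNIV_source)

instance dest :: finite
  by standard (simp add: UNIV_dest)

text \<open>The outcome of a slot when both sources are backlogged: which sources transmit, and for
  which pairs \<open>(n, m)\<close> destination \<open>m\<close> receives the packet of source \<open>n\<close>.\<close>

type_synonym slot = "(source \<Rightarrow> bool) \<times> (source \<times> dest \<Rightarrow> bool)"

text \<open>Here \<open>q_alone n m\<close> is $q_{n|n}^{(m)}$ and \<open>q_both n m\<close> is $q_{n|1,2}^{(m)}$.\<close>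

definition rx_prob ::
  "(source \<Rightarrow> dest \<Rightarrow> real) \<Rightarrow> (source \<Rightarrow> dest \<Rightarrow> real) \<Rightarrow> (source \<Rightarrow> bool) \<Rightarrow> source \<times> dest \<Rightarrow> real"
where
  "rx_prob q_alone q_both tx = (\<lambda>(n, m).
     if \<not> tx n then 0 else if \<forall>n'. tx n' then q_both n m else q_alone n m)"

text \<open>The sources transmit independently of each other; given the set of transmitting sources,
  the receptions of the four source-destination pairs are independent. The reception
  probabilities are thus given as a kernel, so they are meaningful also when the event
  conditioned on has probability zero.\<close>

definition slot_law ::
  "(source \<Rightarrow> real) \<Rightarrow> (source \<Rightarrow> dest \<Rightarrow> real) \<Rightarrow> (source \<Rightarrow> dest \<Rightarrow> real) \<Rightarrow> slot pmf"
where
  "slot_law p q_alone q_both =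
     bind_pmf (Pi_pmf UNIV False (\<lambda>n. bernoulli_pmf (p n)))
       (\<lambda>tx. map_pmf (\<lambda>rx. (tx, rx))
          (Pi_pmf UNIV False (\<lambda>nm. bernoulli_pmf (rx_prob q_alone q_both tx nm))))"

locale backlogged_multicast = prob_space M
  for M :: "'a measure" +
  fixes p :: "source \<Rightarrow> real"
    and q_alone q_both :: "source \<Rightarrow> dest \<Rightarrow> real"
    and slot :: "nat \<Rightarrow> 'a \<Rightarrow> slot"
  assumes p_range: "0 \<le> p n" "p n \<le> 1"
    and q_range: "0 \<le> q_both n m" "q_both n m < q_alone n m" "q_alone n m \<le> 1"
    and slots_indep: "indep_vars (\<lambda>_. count_space UNIV) slot UNIV"
    and slot_distr: "distr M (count_space UNIV) (slot t) = measure_pmf (slot_law p q_alone q_both)"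

text \<open>The retransmission policy of one source along a sample path, where \<open>r t m\<close> says that the
  packet it sends in slot \<open>t\<close> is received at \<open>m\<close>. The state at the beginning of slot \<open>t\<close> consists
  of the index of the current packet and the destinations that already have it. A packet is
  replaced by the next one as soon as both destinations have received it.\<close>

primrec policy_state :: "(nat \<Rightarrow> dest \<Rightarrow> bool) \<Rightarrow> nat \<Rightarrow> nat \<times> dest set" where
  "policy_state r 0 = (0, {})"
| "policy_state r (Suc t) =
     (let (k, H) = policy_state r t; H' = H \<union> {m. r t m}
      in if H' = UNIV then (Suc k, {}) else (k, H'))"

definition current_packet :: "(nat \<Rightarrow> dest \<Rightarrow> bool) \<Rightarrow> nat \<Rightarrow> nat" where
  "current_packet r t = fst (policy_state r t)"

text \<open>The number of slots that packet \<open>k\<close> has been the current one, up to and including its first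
  reception at \<open>m\<close>. The infimum of the empty set is \<open>\<infinity>\<close>. In particular, the time is \<open>\<infinity>\<close> if
  packet \<open>k\<close> never becomes current because an earlier packet is stuck; this has positive
  probability only if one of the geometric parameters is zero.\<close>

definition reception_time :: "(nat \<Rightarrow> dest \<Rightarrow> bool) \<Rightarrow> nat \<Rightarrow> dest \<Rightarrow> enat" where
  "reception_time r k m =
     (INF t\<in>{t. current_packet r t = k \<and> r t m}. enat (card {s. s \<le> t \<and> current_packet r s = k}))"

definition service_time :: "(nat \<Rightarrow> dest \<Rightarrow> bool) \<Rightarrow> nat \<Rightarrow> enat" where
  "service_time r k = (MAX m\<in>{D1, D2}. reception_time r k m)"

definition receptions :: "(nat \<Rightarrow> 'a \<Rightarrow> slot) \<Rightarrow> source \<Rightarrow> 'a \<Rightarrow> nat \<Rightarrow> dest \<Rightarrow> bool" where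
  "receptions slot n \<omega> t m = snd (slot t \<omega>) (n, m)"

definition mean_service_time :: "'a measure \<Rightarrow> (nat \<Rightarrow> 'a \<Rightarrow> slot) \<Rightarrow> source \<Rightarrow> nat \<Rightarrow> ennreal" where
  "mean_service_time M slot n k =
     (\<integral>\<^sup>+ \<omega>. ennreal_of_enat (service_time (receptions slot n \<omega>) k) \<partial>M)"

text \<open>Division in \<^typ>\<open>ennreal\<close> satisfies $1/\infty = 0$.\<close>

definition service_rate :: "'a measure \<Rightarrow> (nat \<Rightarrow> 'a \<Rightarrow> slot) \<Rightarrow> source \<Rightarrow> nat \<Rightarrow> ennreal" where
  "service_rate M slot n k = 1 / mean_service_time M slot n k"

end

theory Submission
  imports Defs
begin

text \<open>Fix a destination \<open>m\<close>. Call packet \<open>k\<close> awaited at \<open>m\<close> in slot \<open>t\<close> if it is the current packet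
  and \<open>m\<close> does not have it yet. On every sample path the number of awaiting slots is at most the
  service time of the packet, and if the service time is finite then \<open>m\<close> receives the packet in
  one of them. Whether \<open>t\<close> is an awaiting slot is determined by the slots before \<open>t\<close>, hence it is
  independent of the receptions in slot \<open>t\<close>. As in Wald's identity, the expected number of
  receptions in awaiting slots is therefore the per-slot reception probability times the expected
  number of awaiting slots. If the mean service time is finite, the former is at least 1, which
  gives the bound.\<close>

section \<open>Sample paths of the retransmission policy\<close>

definition awaits :: "(nat \<Rightarrow> dest \<Rightarrow> bool) \<Rightarrow> nat \<Rightarrow> dest \<Rightarrow> nat \<Rightarrow> bool" where
  "awaits r k m t \<longleftrightarrow> fst (policy_state r t) = k \<and> m \<notin> snd (policy_state r t)"

lemma policy_state_cong:
  assumes "\<And>s. s < t \<Longrightarrow> r s = r' s"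
  shows "policy_state r t = policy_state r' t"
  using assms by (induction t) simp_all

lemma awaits_cong:
  assumes "\<And>s. s < t \<Longrightarrow> r s = r' s"
  shows "awaits r k m t = awaits r' k m t"
  using policy_state_cong[OF assms] by (simp add: awaits_def)

text \<open>The packet index never decreases, and while it stays at \<open>k\<close> the set of
  destinations holding the packet only grows. The induction carries this alternative forward from
  \<open>Suc t\<close>.\<close>

lemma not_awaits_after_reception:
  assumes "current_packet r t = k" "r t m" "t < s"
  shows "\<not> awaits r k m s"
proof -
  have "Suc t \<le> s"
    using \<open>t < s\<close> by simp
  then have "fst (policy_state r s) > k \<or> (fst (policy_state r s) = k \<and> m \<in> snd (policy_state r s))"
  proof (induction s rule: dec_induct)
    case base
    then show ?case
      using assms(1,2) by (auto simp: current_packet_def Let_def split: prod.splits)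
  next
    case (step s)
    then show ?case
      by (auto simp: Let_def split: prod.splits)
  qed
  then show ?thesis
    by (auto simp: awaits_def)
qed

text \<open>The set is emptied at each packet change, so each of its members was added while the
  present packet was already current.\<close>

lemma received_earlier:
  assumes "m \<in> snd (policy_state r t)"
  shows "\<exists>s<t. current_packet r s = current_packet r t \<and> r s m"
  using assms
proof (induction t)
  case (Suc t)
  then show ?case
    by (auto simp: current_packet_def Let_def less_Suc_eq split: prod.splits if_splits)
qed simp

text \<open>Since \<open>enat\<close> is well-ordered, the infimum of a nonempty set is a least
  element; the empty set would give \<infinity>.\<close>

lemma reception_time_attained:
  assumes "reception_time r k m \<noteq> \<infinity>"
  obtains t where "current_packet r t = k" "r t m"
    "reception_time r k m = enat (card {s. s \<le> t \<and> current_packet r s = k})"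
proof -
  let ?X = "(\<lambda>t. enat (card {s. s \<le> t \<and> current_packet r s = k})) `
    {t. current_packet r t = k \<and> r t m}"
  have nonempty: "?X \<noteq> {}"
  proof
    assume "?X = {}"
    then show False
      using assms unfolding reception_time_def by (simp add: Inf_enat_def)
  qed
  then obtain x where "x \<in> ?X"
    by blast
  then have "(LEAST x. x \<in> ?X) \<in> ?X"
    by (rule LeastI)
  then have "reception_time r k m \<in> ?X"
    using nonempty unfolding reception_time_def Inf_enat_def by (simp only: if_False)
  then show thesis
    using that by blast
qed

lemma reception_while_awaiting:
  assumes "reception_time r k m \<noteq> \<infinity>"
  shows "\<exists>t. awaits r k m t \<and> r t m"
proof -
  let ?P = "\<lambda>t. current_packet r t = k \<and> r t m"
  \<comment> \<open>The earliest reception works: had \<open>m\<close> held the packet already,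
    \<open>received_earlier\<close> would yield an earlier one.\<close>
  obtain t where t: "?P t" "\<And>s. s < t \<Longrightarrow> \<not> ?P s"
    using reception_time_attained[OF assms] exists_least_iff[of ?P] by blast
  then have "m \<notin> snd (policy_state r t)"
    using received_earlier[of m r t] by blast
  then show ?thesis
    using t(1) by (auto simp: awaits_def current_packet_def)
qed

text \<open>No awaiting slot comes after a reception, and packet \<open>k\<close> is current in each
  of them, so all are among the slots that the reception time counts.\<close>

lemma awaiting_slots_le_reception_time:
  "(\<Sum>t. of_bool (awaits r k m t)) \<le> ennreal_of_enat (reception_time r k m)"
proof (cases "reception_time r k m = \<infinity>")
  case False
  then obtain t where t: "current_packet r t = k" "r t m"
    "reception_time r k m = enat (card {s. s \<le> t \<and> current_packet r s = k})"
    by (rule reception_time_attained)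
  have "(\<Sum>t. of_bool (awaits r k m t) :: ennreal) = (\<Sum>s\<le>t. of_bool (awaits r k m s))"
    using not_awaits_after_reception[OF t(1,2)] by (intro suminf_finite) (simp_all add: not_le)
  also have "\<dots> \<le> (\<Sum>s\<le>t. of_bool (current_packet r s = k))"
    by (intro sum_mono) (simp add: awaits_def current_packet_def)
  also have "\<dots> = of_nat (card {s. s \<le> t \<and> current_packet r s = k})"
    by (simp add: atMost_def Collect_conj_eq)
  finally show ?thesis
    by (simp add: t(3))
qed simp

lemma reception_time_le_service_time: "reception_time r k m \<le> service_time r k"
  by (cases m) (simp_all add: service_time_def)

text \<open>This is the geometric parameter of the bound, as \<open>reception_prob_eq\<close> shows;
  the abstract form lets both sources be treated at once.\<close>

definition reception_prob ::
  "(source \<Rightarrow> real) \<Rightarrow> (source \<Rightarrow> dest \<Rightarrow> real) \<Rightarrow> (source \<Rightarrow> dest \<Rightarrow> real) \<Rightarrow> source \<Rightarrow> dest \<Rightarrow> real"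
where
  "reception_prob p q_alone q_both n m =
     measure_pmf.prob (slot_law p q_alone q_both) {s. snd s (n, m)}"

section \<open>Independence of a slot from its past, and the Wald-type identity\<close>

context backlogged_multicast
begin

lemma random_variable_slot: "slot t \<in> measurable M (count_space UNIV)"
  using slots_indep by (auto simp: indep_vars_def)

lemma prob_slot_event:
  "prob {\<omega> \<in> space M. Q (slot t \<omega>)} =
     measure_pmf.prob (slot_law p q_alone q_both) {s. Q s}"
proof -
  have "measure_pmf.prob (slot_law p q_alone q_both) {s. Q s} = measure (distr M (count_space UNIV) (slot t)) {s. Q s}"
    by (simp add: slot_distr)
  also have "\<dots> = prob {\<omega> \<in> space M. Q (slot t \<omega>)}"
    by (subst measure_distr) (auto intro!: arg_cong[where f = prob] random_variable_slot)
  finally show ?thesis ..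
qed

text \<open>The slots before \<open>t\<close> and the slot \<open>t\<close> are disjoint blocks of
  an independent family, and by \<open>past\<close> the predicate \<open>A\<close> depends on the
  first block only.\<close>

lemma prob_past_and_present:
  assumes past: "\<And>f g. (\<And>s. s < t \<Longrightarrow> f s = g s) \<Longrightarrow> A f = A g"
  shows "{\<omega> \<in> space M. A (\<lambda>s. slot s \<omega>)} \<in> events"
    and "prob {\<omega> \<in> space M. A (\<lambda>s. slot s \<omega>) \<and> Q (slot t \<omega>)} =
           prob {\<omega> \<in> space M. A (\<lambda>s. slot s \<omega>)} * prob {\<omega> \<in> space M. Q (slot t \<omega>)}"
proof -
  define X where "X \<omega> = restrict (\<lambda>s. slot s \<omega>) {..<t}" for \<omega>
  define Y where "Y \<omega> = restrict (\<lambda>s. slot s \<omega>) {t}" for \<omega>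
  let ?MX = "PiM {..<t} (\<lambda>_. count_space (UNIV :: slot set))"
  let ?MY = "PiM {t} (\<lambda>_. count_space (UNIV :: slot set))"
  \<comment> \<open>A slot has finitely many outcomes, so the product sigma-algebra over a finite
    block is discrete and every predicate of the block is measurable.\<close>
  have MX: "?MX = count_space (PiE {..<t} (\<lambda>_. UNIV))"
    by (rule count_space_PiM_finite) (auto intro: countable_finite)
  have MY: "?MY = count_space (PiE {t} (\<lambda>_. UNIV))"
    by (rule count_space_PiM_finite) (auto intro: countable_finite)
  have indep: "indep_var ?MX X ?MY Y"
    using indep_var_restrict[OF slots_indep, of "{..<t}" "{t}"] by (simp add: X_def[abs_def] Y_def[abs_def])
  let ?A = "{f \<in> PiE {..<t} (\<lambda>_. UNIV). A f}" and ?B = "{f \<in> PiE {t} (\<lambda>_. UNIV). Q (f t)}"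
  \<comment> \<open>\<open>X\<close> is \<open>undefined\<close> from slot \<open>t\<close> on;
    \<open>past\<close> makes this harmless.\<close>
  have AX: "X \<omega> \<in> ?A \<longleftrightarrow> A (\<lambda>s. slot s \<omega>)" for \<omega>
    using past[of "X \<omega>" "\<lambda>s. slot s \<omega>"] by (auto simp: X_def)
  have BY: "Y \<omega> \<in> ?B \<longleftrightarrow> Q (slot t \<omega>)" for \<omega>
    by (auto simp: Y_def)
  have sets: "?A \<in> sets ?MX" "?B \<in> sets ?MY"
    unfolding MX MY by auto
  have X: "X \<in> measurable M ?MX"
    using indep by (rule indep_var_rv1)
  have eqA: "X -` ?A \<inter> space M = {\<omega> \<in> space M. A (\<lambda>s. slot s \<omega>)}"
    unfolding set_eq_iff Int_iff vimage_eq AX by blast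
  have eqB: "Y -` ?B \<inter> space M = {\<omega> \<in> space M. Q (slot t \<omega>)}"
    unfolding set_eq_iff Int_iff vimage_eq BY by blast
  have eqAB: "(\<lambda>\<omega>. (X \<omega>, Y \<omega>)) -` (?A \<times> ?B) \<inter> space M
      = {\<omega> \<in> space M. A (\<lambda>s. slot s \<omega>) \<and> Q (slot t \<omega>)}"
    unfolding set_eq_iff Int_iff vimage_eq mem_Times_iff fst_conv snd_conv AX BY by blast
  show "{\<omega> \<in> space M. A (\<lambda>s. slot s \<omega>)} \<in> events"
    using measurable_sets[OF X sets(1)] by (simp only: eqA)
  show "prob {\<omega> \<in> space M. A (\<lambda>s. slot s \<omega>) \<and> Q (slot t \<omega>)} =
      prob {\<omega> \<in> space M. A (\<lambda>s. slot s \<omega>)} * prob {\<omega> \<in> space M. Q (slot t \<omega>)}"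
    using indep_varD[OF indep sets] by (simp only: eqA eqB eqAB)
qed

text \<open>Independence gives the identity for each slot; nonnegativity allows sum and integral to
  be exchanged, even if the totals are infinite.\<close>

lemma expected_receptions_while_awaiting:
  fixes n m k
  defines "W \<equiv> (\<lambda>t \<omega>. awaits (receptions slot n \<omega>) k m t)"
  shows "(\<integral>\<^sup>+ \<omega>. (\<Sum>t. of_bool (W t \<omega> \<and> receptions slot n \<omega> t m)) \<partial>M)
       = ennreal (reception_prob p q_alone q_both n m) * (\<integral>\<^sup>+ \<omega>. (\<Sum>t. of_bool (W t \<omega>)) \<partial>M)"
    and "Measurable.pred M (\<lambda>\<omega>. W t \<omega> \<and> receptions slot n \<omega> t m)"
proof -
  define A where "A t f = awaits (\<lambda>s m. snd (f s) (n, m)) k m t" for t :: nat and f :: "nat \<Rightarrow> slot"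
  have W: "W t \<omega> = A t (\<lambda>s. slot s \<omega>)" for t \<omega>
    by (simp add: W_def A_def receptions_def[abs_def])
  have past: "A t f = A t g" if "\<And>s. s < t \<Longrightarrow> f s = g s" for t f g
    unfolding A_def using that by (intro awaits_cong) simp
  have [measurable]: "Measurable.pred M (W t)" for t
    unfolding pred_def W by (rule prob_past_and_present(1)[OF past])
  have [measurable]: "Measurable.pred M (\<lambda>\<omega>. receptions slot n \<omega> t m)" for t
    unfolding receptions_def
    by (rule measurable_compose[OF random_variable_slot[of t], where g = "\<lambda>s. snd s (n, m)"]) simp
  show "Measurable.pred M (\<lambda>\<omega>. W t \<omega> \<and> receptions slot n \<omega> t m)"
    by measurable
  have nn: "(\<integral>\<^sup>+ \<omega>. of_bool (R \<omega>) \<partial>M) = ennreal (prob {\<omega> \<in> space M. R \<omega>})"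
    if [measurable]: "Measurable.pred M R" for R
  proof -
    have "(\<integral>\<^sup>+ \<omega>. of_bool (R \<omega>) \<partial>M) = (\<integral>\<^sup>+ \<omega>. indicator {\<omega> \<in> space M. R \<omega>} \<omega> \<partial>M)"
      by (intro nn_integral_cong) (simp add: indicator_def)
    then show ?thesis
      by (simp add: emeasure_eq_measure)
  qed
  have step: "(\<integral>\<^sup>+ \<omega>. of_bool (W t \<omega> \<and> receptions slot n \<omega> t m) \<partial>M)
      = ennreal (reception_prob p q_alone q_both n m) * (\<integral>\<^sup>+ \<omega>. of_bool (W t \<omega>) \<partial>M)" for t
  proof -
    let ?Q = "\<lambda>s. snd s (n, m)"
    have "prob {\<omega> \<in> space M. W t \<omega> \<and> receptions slot n \<omega> t m}
        = prob {\<omega> \<in> space M. W t \<omega>} * reception_prob p q_alone q_both n m"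
      unfolding W receptions_def reception_prob_def
      using prob_past_and_present(2)[of t "A t" ?Q, OF past] prob_slot_event[of ?Q t] by (simp only:)
    then show ?thesis
      by (subst (1 2) nn) (simp_all add: mult.commute reception_prob_def flip: ennreal_mult)
  qed
  show "(\<integral>\<^sup>+ \<omega>. (\<Sum>t. of_bool (W t \<omega> \<and> receptions slot n \<omega> t m)) \<partial>M)
       = ennreal (reception_prob p q_alone q_both n m) * (\<integral>\<^sup>+ \<omega>. (\<Sum>t. of_bool (W t \<omega>)) \<partial>M)"
    by (simp add: nn_integral_suminf step)
qed

text \<open>Treating one destination at a time avoids the joint law of the two reception
  times.\<close>

lemma service_rate_le_reception_prob:
  "service_rate M slot n k \<le> ennreal (reception_prob p q_alone q_both n m)"
proof -
  let ?T = "\<lambda>\<omega>. service_time (receptions slot n \<omega>) k"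
  let ?E = "mean_service_time M slot n k"
  let ?a = "ennreal (reception_prob p q_alone q_both n m)"
  define S :: "_ \<Rightarrow> ennreal" where
    "S \<omega> = (\<Sum>t. of_bool (awaits (receptions slot n \<omega>) k m t \<and> receptions slot n \<omega> t m))" for \<omega>
  have [measurable]: "S \<in> borel_measurable M"
    unfolding S_def using expected_receptions_while_awaiting(2)[of n k m] by measurable
  have S_ge_1: "1 \<le> S \<omega>" if "?T \<omega> \<noteq> \<infinity>" for \<omega>
  proof -
    have "reception_time (receptions slot n \<omega>) k m \<noteq> \<infinity>"
      using that reception_time_le_service_time[of "receptions slot n \<omega>" k m]
      by (metis enat_ord_simps(5))
    then obtain t where t: "awaits (receptions slot n \<omega>) k m t \<and> receptions slot n \<omega> t m"
      using reception_while_awaiting by blast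
    then show ?thesis
      using sum_le_suminf[of "\<lambda>t. of_bool (awaits (receptions slot n \<omega>) k m t \<and> receptions slot n \<omega> t m) :: ennreal" "{t}"]
      by (simp add: S_def)
  qed
  show ?thesis
  proof (cases "?E = \<infinity>")
    case True
    then show ?thesis
      by (simp add: service_rate_def)
  next
    case False
    \<comment> \<open>The service time is not known to be measurable, so its finiteness almost everywhere is
      routed through the measurable set where \<open>S\<close> is below 1.\<close>
    have "(\<integral>\<^sup>+ \<omega>. \<infinity> * indicator {\<omega> \<in> space M. S \<omega> < 1} \<omega> \<partial>M) \<le> ?E"
      unfolding mean_service_time_def
    proof (intro nn_integral_mono)
      fix \<omega>
      show "\<infinity> * indicator {\<omega> \<in> space M. S \<omega> < 1} \<omega> \<le> ennreal_of_enat (?T \<omega>)"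
        using S_ge_1[of \<omega>] by (cases "?T \<omega> = \<infinity>") (auto simp: indicator_def)
    qed
    moreover have "(\<integral>\<^sup>+ \<omega>. \<infinity> * indicator {\<omega> \<in> space M. S \<omega> < 1} \<omega> \<partial>M)
        = \<infinity> * emeasure M {\<omega> \<in> space M. S \<omega> < 1}"
      by (rule nn_integral_cmult_indicator) measurable
    \<comment> \<open>\<infinity> times this measure is at most the finite mean, which forces the
      measure to vanish.\<close>
    ultimately have "emeasure M {\<omega> \<in> space M. S \<omega> < 1} = 0"
      using False by (auto simp: ennreal_top_mult top_unique split: if_splits)
    then have "AE \<omega> in M. 1 \<le> S \<omega>"
      by (intro AE_I[of _ _ "{\<omega> \<in> space M. S \<omega> < 1}"]) auto
    then have "(\<integral>\<^sup>+ \<omega>. 1 \<partial>M) \<le> (\<integral>\<^sup>+ \<omega>. S \<omega> \<partial>M)"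
      by (rule nn_integral_mono_AE)
    then have "1 \<le> (\<integral>\<^sup>+ \<omega>. S \<omega> \<partial>M)"
      by (simp add: emeasure_space_1)
    also have "\<dots> = ?a * (\<integral>\<^sup>+ \<omega>. (\<Sum>t. of_bool (awaits (receptions slot n \<omega>) k m t)) \<partial>M)"
      unfolding S_def by (rule expected_receptions_while_awaiting)
    also have "\<dots> \<le> ?a * ?E"
      unfolding mean_service_time_def
    proof (intro mult_left_mono nn_integral_mono)
      show "(\<Sum>t. of_bool (awaits (receptions slot n \<omega>) k m t)) \<le> ennreal_of_enat (?T \<omega>)" for \<omega>
        using awaiting_slots_le_reception_time reception_time_le_service_time
        by (rule order_trans[OF _ ennreal_of_enat_le_iff[THEN iffD2]])
    qed simp
    finally have "1 \<le> ?a * ?E" .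
    \<comment> \<open>In \<open>ennreal\<close>, 1/0 is \<infinity>, so a zero mean has to be
      excluded before dividing.\<close>
    moreover from this have "?E \<noteq> 0"
      by auto
    ultimately have "1 / ?E \<le> ?a"
      using False by (simp add: divide_le_posI_ennreal mult.commute zero_less_iff_neq_zero)
    then show ?thesis
      by (simp add: service_rate_def)
  qed
qed

section \<open>The per-slot reception probability in closed form\<close>

lemma rx_prob_range: "0 \<le> rx_prob q_alone q_both tx nm" "rx_prob q_alone q_both tx nm \<le> 1"
  using q_range[of "fst nm" "snd nm"] by (auto simp: rx_prob_def split: prod.splits)

text \<open>The marginal of the product law at one pair is its Bernoulli factor, so only the average
  over the transmitting sets remains.\<close>

lemma reception_prob_eq_expectation:
  "reception_prob p q_alone q_both n m =
     measure_pmf.expectation (Pi_pmf UNIV False (\<lambda>n. bernoulli_pmf (p n)))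
       (\<lambda>tx. rx_prob q_alone q_both tx (n, m))"
proof -
  have "map_pmf (\<lambda>s. snd s (n, m)) (slot_law p q_alone q_both) =
      bind_pmf (Pi_pmf UNIV False (\<lambda>n. bernoulli_pmf (p n)))
        (\<lambda>tx. bernoulli_pmf (rx_prob q_alone q_both tx (n, m)))"
    by (simp add: slot_law_def map_bind_pmf pmf.map_comp o_def Pi_pmf_component)
  then have "pmf (map_pmf (\<lambda>s. snd s (n, m)) (slot_law p q_alone q_both)) True =
      measure_pmf.expectation (Pi_pmf UNIV False (\<lambda>n. bernoulli_pmf (p n)))
       (\<lambda>tx. rx_prob q_alone q_both tx (n, m))"
    by (simp add: pmf_bind rx_prob_range)
  then show ?thesis
    by (simp add: reception_prob_def pmf_map vimage_def)
qed

text \<open>Of the four transmission patterns, those with the source silent contribute 0; the other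
  two give the terms with \<open>q_alone\<close> and \<open>q_both\<close>.\<close>

lemma reception_prob_eq:
  "reception_prob p q_alone q_both S1 m = p S1 * (1 - p S2) * q_alone S1 m + p S1 * p S2 * q_both S1 m"
  "reception_prob p q_alone q_both S2 m = (1 - p S1) * p S2 * q_alone S2 m + p S1 * p S2 * q_both S2 m"
proof -
  have tx: "Pi_pmf UNIV False (\<lambda>n. bernoulli_pmf (p n)) =
      bind_pmf (bernoulli_pmf (p S1)) (\<lambda>x. bind_pmf (bernoulli_pmf (p S2))
        (\<lambda>y. return_pmf ((\<lambda>_. False)(S2 := y, S1 := x))))"
    unfolding UNIV_source
    by (simp add: Pi_pmf_insert Pi_pmf_singleton pair_pmf_def map_bind_pmf
        map_pmf_def bind_assoc_pmf bind_return_pmf fun_upd_def)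
  \<comment> \<open>Conditioning on one Bernoulli draw; it is applied once per source.\<close>
  have bind: "measure_pmf.expectation (bind_pmf (bernoulli_pmf a) g) h =
      a * measure_pmf.expectation (g True) h + (1 - a) * measure_pmf.expectation (g False) h"
    if "0 \<le> a" "a \<le> 1" "\<And>x. finite (set_pmf (g x))"
    for a g and h :: "(source \<Rightarrow> bool) \<Rightarrow> real"
    using that by (subst pmf_expectation_bind[of UNIV]) (auto simp: UNIV_bool)
  have all: "(\<forall>n. f n) \<longleftrightarrow> f S1 \<and> f S2" for f
    using source.exhaust by (metis (full_types))
  show "reception_prob p q_alone q_both S1 m = p S1 * (1 - p S2) * q_alone S1 m + p S1 * p S2 * q_both S1 m"
    "reception_prob p q_alone q_both S2 m = (1 - p S1) * p S2 * q_alone S2 m + p S1 * p S2 * q_both S2 m"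
    unfolding reception_prob_eq_expectation tx
    by (simp_all add: bind p_range rx_prob_def all algebra_simps)
qed

end

theorem mainTheorem3:
  fixes M :: "'a measure"
    and p :: "source \<Rightarrow> real"
    and q_alone q_both :: "source \<Rightarrow> dest \<Rightarrow> real"
    and slot :: "nat \<Rightarrow> 'a \<Rightarrow> slot"
    and k :: nat
  assumes "backlogged_multicast M p q_alone q_both slot"
  shows "service_rate M slot S1 k
           \<le> ennreal (MIN m\<in>{D1, D2}. p S1 * (1 - p S2) * q_alone S1 m + p S1 * p S2 * q_both S1 m)
       \<and> service_rate M slot S2 k
           \<le> ennreal (MIN m\<in>{D1, D2}. (1 - p S1) * p S2 * q_alone S2 m + p S1 * p S2 * q_both S2 m)"
proof -
  interpret backlogged_multicast M p q_alone q_both slot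
    by (fact assms)
  show ?thesis
    using service_rate_le_reception_prob[of S1 k] service_rate_le_reception_prob[of S2 k]
    unfolding reception_prob_eq by (simp add: min_def)
qed

end
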